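(* Fix a customer $k\in V_0$ and a routing decision $\boldsymbol{y}^k$, and let $a_w^k,a_\ell^k,a_u^k\in(0,1]$ with $\frac{a_w^k}{a_\ell^k}+\frac{a_w^k}{a_u^k}\le 1$. Let $\boldsymbol t^{[1]},\dots,\boldsymbol t^{[Q]}$ be travel time samples, indexed so that the arrival times $\tilde\tau^{k[q]}=\sum_{(i,j)\in A}t_{ij}^{[q]}y_{ij}^k$ satisfy $\tilde\tau^{k[1]}\le\tilde\tau^{k[2]}\le\dots\le\tilde\tau^{k[Q]}$. Let $P_1^k,P_2^k\in\{1,\dots,Q\}$ be the indices such that $$\frac1Q\sum_{q=1}^{P_1^k-1}a_\ell^k<a_w^k\le\frac1Q\sum_{q=1}^{P_1^k}a_\ell^k,\qquad \frac1Q\sum_{q=P_2^k+1}^{Q}a_u^k<a_w^k\le\frac1Q\sum_{q=P_2^k}^{Q}a_u^k .$$ Consider the linear program in the variables $\ell^k,u^k,(v_1^{k[q]})_{q=1}^Q,(v_2^{k[q]})_{q=1}^Q$: $$\min\ a_w^k(u^k-\ell^k)+\frac{a_\ell^k}{Q}\sum_{q=1}^Qv_1^{k[q]}+\frac{a_u^k}{Q}\sum_{q=1}^Qv_2^{k[q]}$$ subject to, for all $q\in\{1,\dots,Q\}$, $$\ell^k-\sum_{(i,j)\in A}t_{ij}^{[q]}y_{ij}^k\le v_1^{k[q]},\qquad \sum_{(i,j)\in A}t_{ij}^{[q]}y_{ij}^k-u^k\le v_2^{k[q]},\qquad 0\le\ell^k\le u^k,\qquad v_1^{k[q]},v_2^{k[q]}\ge0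 .$$ Then an optimal solution is given by $$\bar\ell^k=\tilde\tau^{k[P_1^k]}=\sum_{(i,j)\in A}t_{ij}^{[P_1^k]}y_{ij}^k,\qquad \bar u^k=\tilde\tau^{k[P_2^k]}=\sum_{(i,j)\in A}t_{ij}^{[P_2^k]}y_{ij}^k,$$ together with $$\bar v_1^{k[q]}=\begin{cases}\tilde\tau^{k[P_1^k]}-\tilde\tau^{k[q]}, & q=1,\dots,P_1^k-1,\\ 0,& q=P_1^k,\dots,Q,\end{cases}\qquad \bar v_2^{k[q]}=\begin{cases}0,& q=1,\dots,P_2^k,\\ \tilde\tau^{k[q]}-\tilde\tau^{k[P_2^k]},& q=P_2^k+1,\dots,Q.\end{cases}$$
   Context: $V_0=\{1,\dots,n\}$ is the set of customers, $0$ is the depot, and $A$ is the set of directed links between locations in $\{0,1,\dots,n\}$. The routing decision $\boldsymbol{y}^k\in\{0,1\}^{|A|}$ is the incidence vector of a path from the depot $0$ to customer $k$. Each sample $\boldsymbol t^{[q]}=(t^{[q]}_{ij})_{(i,j)\in A}$ is a vector of nonnegative travel times. *)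

theory Defs
  imports Complex_Main "Graph_Theory.Arc_Walk"
begin

text \<open>
  Locations are the numbers \<open>0, \<dots>, n\<close> with depot \<open>0\<close>; a link is an ordered pair of locations.
  The link set \<open>A\<close> need not be the complete one.
\<close>

definition network :: "nat \<Rightarrow> (nat \<times> nat) set \<Rightarrow> (nat, nat \<times> nat) pre_digraph" where
  "network n A = \<lparr>verts = {0..n}, arcs = A, tail = fst, head = snd\<rparr>"

text \<open>
  Routing decisions and travel times are vectors indexed by \<open>A\<close>, represented as functions on all
  pairs; values outside \<open>A\<close> are unconstrained and never used.
\<close>

definition path_incidence_vector ::
  "nat \<Rightarrow> (nat \<times> nat) set \<Rightarrow> nat \<Rightarrow> (nat \<times> nat \<Rightarrow> real) \<Rightarrow> bool" where
  "path_incidence_vector n A k y \<longleftrightarrow>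
     (\<exists>p. pre_digraph.apath (network n A) 0 p k \<and> (\<forall>a\<in>A. y a = (if a \<in> set p then 1 else 0)))"

definition arrival_time ::
  "(nat \<times> nat) set \<Rightarrow> (nat \<times> nat \<Rightarrow> real) \<Rightarrow> (nat \<times> nat \<Rightarrow> real) \<Rightarrow> real" where
  "arrival_time A y s = (\<Sum>(i, j)\<in>A. s (i, j) * y (i, j))"

text \<open>
  A point of the linear program is a tuple \<open>(l, u, v1, v2)\<close>, where only the values of \<open>v1\<close> and
  \<open>v2\<close> on \<open>{1..Q}\<close> matter; \<open>t q\<close> is the \<open>q\<close>-th travel time sample.
\<close>

type_synonym lp_point = "real \<times> real \<times> (nat \<Rightarrow> real) \<times> (nat \<Rightarrow> real)"

fun lp_objective :: "real \<Rightarrow> real \<Rightarrow> real \<Rightarrow> nat \<Rightarrow> lp_point \<Rightarrow> real" where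
  "lp_objective aw al au Q (l, u, v1, v2) =
     aw * (u - l) + al / real Q * (\<Sum>q=1..Q. v1 q) + au / real Q * (\<Sum>q=1..Q. v2 q)"

fun lp_feasible ::
  "(nat \<times> nat) set \<Rightarrow> (nat \<times> nat \<Rightarrow> real) \<Rightarrow> nat \<Rightarrow> (nat \<Rightarrow> nat \<times> nat \<Rightarrow> real) \<Rightarrow> lp_point \<Rightarrow> bool"
where
  "lp_feasible A y Q t (l, u, v1, v2) \<longleftrightarrow>
     (\<forall>q\<in>{1..Q}. l - arrival_time A y (t q) \<le> v1 q) \<and>
     (\<forall>q\<in>{1..Q}. arrival_time A y (t q) - u \<le> v2 q) \<and>
     0 \<le> l \<and> l \<le> u \<and>
     (\<forall>q\<in>{1..Q}. v1 q \<ge> 0 \<and> v2 q \<ge> 0)"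

end

theory Submission
  imports Defs
begin

text \<open>
  The objective splits into a part that depends on \<open>l\<close> and \<open>v1\<close> and a part that depends on \<open>u\<close>
  and \<open>v2\<close>; only the constraint \<open>l \<le> u\<close> couples them. Each part on its own is a newsvendor problem:
  choose a threshold that trades a linear reward of slope \<open>aw\<close> against a penalty of slope \<open>al / Q\<close>
  (or \<open>au / Q\<close>) for every sample on the wrong side. Its optimum is the empirical quantile at which
  the accumulated penalty slope first reaches \<open>aw\<close>, which is what \<open>P1\<close> and \<open>P2\<close> describe. LP duality
  certifies this (\<open>newsvendor_lower_bound\<close>): the samples strictly beyond the quantile carry their
  full penalty as dual multiplier and the quantile itself carries the remainder. The upper
  problem is the lower one after negating all times.

  The two separate optima are compatible with \<open>l \<le> u\<close> because of the ratio condition: \<open>P1 - 1\<close>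
  is less than \<open>Q * aw / al\<close> and \<open>Q - P2\<close> is less than \<open>Q * aw / au\<close>, so fewer than \<open>Q\<close> samples
  lie outside the window in total, which forces \<open>P1 \<le> P2\<close> (\<open>quantile_indices_ordered\<close>).
\<close>

text \<open>
  A weak duality bound. The dual multipliers are \<open>c\<close> on \<open>L\<close>, \<open>w - c * card L\<close> at \<open>p\<close> and zero
  elsewhere; they sum to \<open>w\<close>, so that \<open>x\<close> cancels. The two bounds on \<open>w\<close> say exactly that
  the multiplier at \<open>p\<close> lies between \<open>0\<close> and \<open>c\<close>.
\<close>

lemma newsvendor_lower_bound:
  fixes f v :: "'a \<Rightarrow> real" and c w x :: real
  assumes fin: "finite S" and L: "L \<subseteq> S" and p: "p \<in> S" "p \<notin> L"
    and c: "0 \<le> c" and w: "c * card L \<le> w" "w \<le> c * (card L + 1)"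
    and v_nonneg: "\<And>q. q \<in> S \<Longrightarrow> 0 \<le> v q" and v_ge: "\<And>q. q \<in> S \<Longrightarrow> x - f q \<le> v q"
  shows "c * (\<Sum>q\<in>L. f p - f q) - w * f p \<le> c * (\<Sum>q\<in>S. v q) - w * x"
proof -
  have finL: "finite L"
    using L fin by (rule finite_subset)
  define r where "r = w - c * card L"
  have r: "0 \<le> r" "r \<le> c"
    using w by (auto simp: r_def algebra_simps)
  have "r * (x - f p) \<le> r * v p"
    using r(1) v_ge[OF p(1)] by (rule mult_left_mono[rotated])
  also have "\<dots> \<le> c * v p"
    using r(2) v_nonneg[OF p(1)] by (rule mult_right_mono)
  finally have at_p: "r * (x - f p) \<le> c * v p" .
  have "(\<Sum>q\<in>L. x - f q) \<le> (\<Sum>q\<in>L. v q)"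
    using L v_ge by (intro sum_mono) auto
  then have on_L: "c * (\<Sum>q\<in>L. x - f q) \<le> c * (\<Sum>q\<in>L. v q)"
    using c by (rule mult_left_mono)
  have "(\<Sum>q\<in>insert p L. v q) \<le> (\<Sum>q\<in>S. v q)"
    using L p fin v_nonneg by (intro sum_mono2) auto
  then have "v p + (\<Sum>q\<in>L. v q) \<le> (\<Sum>q\<in>S. v q)"
    using finL p(2) by simp
  then have "c * (v p + (\<Sum>q\<in>L. v q)) \<le> c * (\<Sum>q\<in>S. v q)"
    using c by (rule mult_left_mono)
  then have "r * (x - f p) + c * (\<Sum>q\<in>L. x - f q) \<le> c * (\<Sum>q\<in>S. v q)"
    using at_p on_L by (simp add: distrib_left)
  then show ?thesis
    by (simp add: sum_subtractf r_def algebra_simps)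
qed

lemma quantile_indices_ordered:
  fixes Q P1 P2 :: nat and aw al au :: real
  assumes pos: "0 < al" "0 < au"
    and ratio: "aw / al + aw / au \<le> 1"
    and P1: "al * (real P1 - 1) < aw * Q"
    and P2: "au * (real Q - real P2) < aw * Q"
  shows "P1 \<le> P2"
proof -
  have "real P1 - 1 < aw / al * Q"
    using P1 pos by (simp add: field_simps)
  moreover have "real Q - real P2 < aw / au * Q"
    using P2 pos by (simp add: field_simps)
  moreover have "(aw / al + aw / au) * Q \<le> 1 * real Q"
    using ratio by (rule mult_right_mono) simp
  ultimately have "real P1 - 1 < real P2"
    by (simp add: distrib_right)
  then show ?thesis
    by linarith
qed

lemma arrival_time_nonneg:
  assumes "path_incidence_vector n A k y" and "\<forall>a\<in>A. 0 \<le> s a"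
  shows "0 \<le> arrival_time A y s"
proof -
  have "0 \<le> y a" if "a \<in> A" for a
    using assms(1) that by (auto simp: path_incidence_vector_def)
  then show ?thesis
    using assms(2) unfolding arrival_time_def by (intro sum_nonneg) auto
qed

theorem proposition3:
  fixes n k Q P1 P2 :: nat
    and A :: "(nat \<times> nat) set"
    and y :: "nat \<times> nat \<Rightarrow> real"
    and t :: "nat \<Rightarrow> nat \<times> nat \<Rightarrow> real"
    and aw al au :: real
    and \<tau> :: "nat \<Rightarrow> real"
  assumes links: "A \<subseteq> {0..n} \<times> {0..n}"
    and customer: "k \<in> {1..n}"
    and routing: "path_incidence_vector n A k y"
    and weights: "aw \<in> {0<..1}" "al \<in> {0<..1}" "au \<in> {0<..1}"
    and ratio: "aw / al + aw / au \<le> 1"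
    and nonneg: "\<forall>q\<in>{1..Q}. \<forall>a\<in>A. t q a \<ge> 0"
    and arrival: "\<forall>q\<in>{1..Q}. \<tau> q = arrival_time A y (t q)"
    and sorted: "mono_on {1..Q} \<tau>"
    and P1: "P1 \<in> {1..Q}"
      "1 / real Q * (\<Sum>q=1..P1 - 1. al) < aw" "aw \<le> 1 / real Q * (\<Sum>q=1..P1. al)"
    and P2: "P2 \<in> {1..Q}"
      "1 / real Q * (\<Sum>q=P2 + 1..Q. au) < aw" "aw \<le> 1 / real Q * (\<Sum>q=P2..Q. au)"
  shows "is_arg_min (lp_objective aw al au Q) (lp_feasible A y Q t)
    (\<tau> P1, \<tau> P2,
     \<lambda>q. if q < P1 then \<tau> P1 - \<tau> q else 0,
     \<lambda>q. if q \<le> P2 then 0 else \<tau> q - \<tau> P2)"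
proof -
  define vl where "vl q = (if q < P1 then \<tau> P1 - \<tau> q else 0)" for q
  define vu where "vu q = (if q \<le> P2 then 0 else \<tau> q - \<tau> P2)" for q
  have Q: "0 < real Q" and pos: "0 < aw" "0 < al" "0 < au"
    using P1(1) weights by auto
  have P1_lo: "al * (real P1 - 1) < aw * Q" and P1_hi: "aw * Q \<le> al * P1"
    using P1 Q by (auto simp: field_simps of_nat_diff)
  have P2_lo: "au * (real Q - real P2) < aw * Q" and P2_hi: "aw * Q \<le> au * (real Q - real P2 + 1)"
    using P2 Q by (auto simp: field_simps of_nat_diff Suc_diff_le)
  have "P1 \<le> P2"
    using pos(2,3) ratio P1_lo P2_lo by (rule quantile_indices_ordered)
  have \<tau>_mono: "\<tau> i \<le> \<tau> j" if "i \<in> {1..Q}" "j \<in> {1..Q}" "i \<le> j" for i j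
    using mono_onD[OF sorted] that by blast
  have feasible: "lp_feasible A y Q t (\<tau> P1, \<tau> P2, vl, vu)"
  proof -
    have "0 \<le> \<tau> P1"
      using arrival_time_nonneg[OF routing] nonneg arrival P1(1) by auto
    moreover have "\<tau> P1 \<le> \<tau> P2"
      using \<tau>_mono P1(1) P2(1) \<open>P1 \<le> P2\<close> by blast
    moreover have "\<tau> P1 - \<tau> q \<le> vl q \<and> \<tau> q - \<tau> P2 \<le> vu q \<and> 0 \<le> vl q \<and> 0 \<le> vu q"
      if "q \<in> {1..Q}" for q
      using \<tau>_mono[OF P1(1) that] \<tau>_mono[OF that P1(1)]
        \<tau>_mono[OF P2(1) that] \<tau>_mono[OF that P2(1)]
      by (auto simp: vl_def vu_def)
    ultimately show ?thesis
      using arrival by auto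
  qed
  have sum_vl: "(\<Sum>q=1..Q. vl q) = (\<Sum>q\<in>{1..<P1}. \<tau> P1 - \<tau> q)"
    using P1(1) by (intro sum.mono_neutral_cong_right) (auto simp: vl_def)
  have sum_vu: "(\<Sum>q=1..Q. vu q) = (\<Sum>q\<in>{P2<..Q}. \<tau> q - \<tau> P2)"
    using P2(1) by (intro sum.mono_neutral_cong_right) (auto simp: vu_def)
  have optimal: "lp_objective aw al au Q (\<tau> P1, \<tau> P2, vl, vu)
      \<le> lp_objective aw al au Q (l, u, v1, v2)"
    if "lp_feasible A y Q t (l, u, v1, v2)" for l u v1 v2
  proof -
    have "al / Q * (\<Sum>q\<in>{1..<P1}. \<tau> P1 - \<tau> q) - aw * \<tau> P1 \<le> al / Q * (\<Sum>q=1..Q. v1 q) - aw * l"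
      by (rule newsvendor_lower_bound)
        (use that arrival pos Q P1(1) P1_lo P1_hi in \<open>auto simp: field_simps of_nat_diff\<close>)
    \<comment> \<open>Times are negated: being late beyond \<open>u\<close> is being early before \<open>- u\<close>.\<close>
    moreover have "au / Q * (\<Sum>q\<in>{P2<..Q}. - \<tau> P2 - - \<tau> q) - aw * - \<tau> P2
        \<le> au / Q * (\<Sum>q=1..Q. v2 q) - aw * - u"
      by (rule newsvendor_lower_bound)
        (use that arrival pos Q P2(1) P2_lo P2_hi in \<open>auto simp: field_simps of_nat_diff\<close>)
    ultimately show ?thesis
      unfolding lp_objective.simps sum_vl sum_vu by (simp add: right_diff_distrib)
  qed
  have "is_arg_min (lp_objective aw al au Q) (lp_feasible A y Q t) (\<tau> P1, \<tau> P2, vl, vu)"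
    unfolding is_arg_min_def using feasible optimal
    by (auto simp: not_less simp del: lp_objective.simps lp_feasible.simps)
  then show ?thesis
    by (simp only: vl_def[abs_def] vu_def[abs_def])
qed

end
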